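(* For $y=(y_1,\ldots,y_7)\in\mathbb{R}^7$ and $0\le r\le 7$ let $E_r(y)=\sum_{1\le i_1<\cdots<i_r\le 7} y_{i_1}\cdots y_{i_r}$ be the elementary symmetric polynomials (with $E_0=1$). Define $$P(y)=\frac{21+4E_2(y)+4E_3(y)+E_4(y)}{280},\qquad f:\mathbb{R}^7\to\mathbb{R},\quad f(x)=P(\cos x_1,\ldots,\cos x_7).$$ Then $f$ is bounded, continuous, nonnegative (i.e. $f(x)\ge 0$ for all $x\in\mathbb{R}^7$), and positive definite on $\mathbb{R}^7$, with $f(0)=1$. Moreover, for the eight points $x_0=0$ and $x_j=\pi\mathbf{e}_j$ $(1\le j\le 7)$ in $\mathbb{R}^7$, where $\mathbf{e}_1,\ldots,\mathbf{e}_7$ are the standard coordinate vectors, and the coefficients $c_0=-1$, $c_1=\cdots=c_7=1$, one has $$\sum_{j,k=0}^{7} c_jc_k f(x_j-x_k)-\frac18\Bigl(\sum_{j=0}^{7}c_j\Bigr)^2=-\frac1{10}.$$ In particular, the following assertion is false: for every $d\ge 1$, every bounded, continuous, nonnegative, positive definite function $h:\mathbb{R}^d\to\mathbb{R}$ with $h(0)=1$, every $n\ge 1$ and all $x_1,\ldots,x_n\in\mathbb{R}^d$, the matrix $[h(x_j-x_k)]_{j,k=1}^n-\frac1n J_n$ is positive semidefinite, where $J_n$ is the $n\times n$ all-ones matrix.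
   Context: A function $f:\mathbb{R}^d\to\mathbb{C}$ is called positive definite if for every $n\ge 1$, all $x_1,\ldots,x_n\in\mathbb{R}^d$, and all $c_1,\ldots,c_n\in\mathbb{C}$, the sum $\sum_{j,k=1}^n \overline{c_j}\,c_k f(x_j-x_k)$ is real and $\ge 0$ (strict positivity is not required). "Nonnegative" refers to the pointwise values of the function and is a separate condition from positive definiteness. *)

theory Defs
  imports
    "HOL-Analysis.Analysis"
    "HOL-Library.Function_Algebras"
    "Jordan_Normal_Form.Matrix"
begin

text \<open>
  The dimension is quantified inside the theorem, so \<open>\<real>\<^sup>d\<close> cannot be a type. It is the
  topological space \<^const>\<open>Euclidean_space\<close> \<open>d\<close>, whose points are the sequences \<open>nat \<Rightarrow> real\<close>
  vanishing from index \<open>d\<close> on, with the product topology; subtraction is pointwise.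
  The coordinates \<open>y\<^sub>1, \<dots>, y\<^sub>d\<close> are \<open>y 0, \<dots>, y (d - 1)\<close>. A function on \<open>\<real>\<^sup>d\<close> is a HOL function on
  \<open>nat \<Rightarrow> real\<close> of which only the values on \<open>Rn d\<close> are used.
\<close>

abbreviation Rn :: "nat \<Rightarrow> (nat \<Rightarrow> real) set" where
  "Rn d \<equiv> topspace (Euclidean_space d)"

definition positive_definite :: "nat \<Rightarrow> ((nat \<Rightarrow> real) \<Rightarrow> complex) \<Rightarrow> bool" where
  "positive_definite d f \<longleftrightarrow>
    (\<forall>n\<ge>1. \<forall>(x :: nat \<Rightarrow> nat \<Rightarrow> real) (c :: nat \<Rightarrow> complex). (\<forall>j<n. x j \<in> Rn d) \<longrightarrow>
      (\<Sum>j<n. \<Sum>k<n. cnj (c j) * c k * f (x j - x k)) \<in> \<real> \<and>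
      Re (\<Sum>j<n. \<Sum>k<n. cnj (c j) * c k * f (x j - x k)) \<ge> 0)"

text \<open>The vector \<open>e\<^sub>j\<close>, where \<open>j\<close> is counted from 1.\<close>

definition unit_vector :: "nat \<Rightarrow> nat \<Rightarrow> real" where
  "unit_vector j = (\<lambda>i. if Suc i = j then 1 else 0)"

definition elem_sym :: "nat \<Rightarrow> nat \<Rightarrow> (nat \<Rightarrow> real) \<Rightarrow> real" where
  "elem_sym n r y = (\<Sum>I | I \<subseteq> {..<n} \<and> card I = r. \<Prod>i\<in>I. y i)"

definition P7 :: "(nat \<Rightarrow> real) \<Rightarrow> real" where
  "P7 y = (21 + 4 * elem_sym 7 2 y + 4 * elem_sym 7 3 y + elem_sym 7 4 y) / 280"

definition f7 :: "(nat \<Rightarrow> real) \<Rightarrow> real" where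
  "f7 x = P7 (\<lambda>i. cos (x i))"

definition all_ones_mat :: "nat \<Rightarrow> real mat" where
  "all_ones_mat n = Matrix.mat n n (\<lambda>_. 1)"

definition pos_semidef_mat :: "real mat \<Rightarrow> bool" where
  "pos_semidef_mat A \<longleftrightarrow> square_mat A \<and> transpose_mat A = A \<and>
    (\<forall>v \<in> carrier_vec (dim_row A). scalar_prod v (A *\<^sub>v v) \<ge> 0)"

end

theory Submission
  imports Defs
begin

text \<open>
  Since \<open>P\<close> is affine in each variable, its minimum on the cube \<open>[-1, 1]\<^sup>7\<close> is attained at a vertex, and
  at the vertices with \<open>0, \<dots>, 7\<close> entries \<open>-1\<close> the values of \<open>280 P\<close> are
  \<open>280, 72, 0, 0, 24, 40, 32, 0\<close>. Positive definiteness holds because \<open>P\<close> has nonnegative coefficients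
  and, by the addition theorem, multiplication by \<open>cos x\<^sub>i\<close> preserves positive definiteness.
  In the quadratic form, each pair of \<open>x\<^sub>0\<close> and some \<open>x\<^sub>j\<close> contributes \<open>-72/280\<close>
  and pairs of distinct nonzero points contribute nothing.
\<close>

section \<open>Positive definite functions and \<open>f7\<close>\<close>

lemma positive_definite_const:
  assumes "0 \<le> a"
  shows "positive_definite d (\<lambda>x. complex_of_real a)"
  unfolding positive_definite_def
proof (intro allI impI)
  fix n :: nat and x :: "nat \<Rightarrow> nat \<Rightarrow> real" and c :: "nat \<Rightarrow> complex"
  let ?s = "\<Sum>k<n. c k"
  \<comment> \<open>For a constant kernel the double sum factors into \<open>a\<close> times the
    squared modulus of the sum of the coefficients.\<close>
  have "(\<Sum>j<n. \<Sum>k<n. cnj (c j) * c k * complex_of_real a) = complex_of_real a * (cnj ?s * ?s)"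
    by (simp add: sum_product sum_distrib_left mult_ac)
  also have "cnj ?s * ?s = complex_of_real ((cmod ?s)\<^sup>2)"
    by (metis complex_norm_square mult.commute)
  finally have "(\<Sum>j<n. \<Sum>k<n. cnj (c j) * c k * complex_of_real a)
      = complex_of_real (a * (cmod ?s)\<^sup>2)"
    by simp
  then show "(\<Sum>j<n. \<Sum>k<n. cnj (c j) * c k * complex_of_real a) \<in> \<real> \<and>
      0 \<le> Re (\<Sum>j<n. \<Sum>k<n. cnj (c j) * c k * complex_of_real a)"
    using assms by (simp only: Reals_of_real Re_complex_of_real) simp
qed

lemma positive_definite_add:
  assumes "positive_definite d f" "positive_definite d g"
  shows "positive_definite d (\<lambda>x. f x + g x)"
  using assms unfolding positive_definite_def
  by (simp add: ring_distribs sum.distrib)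

lemma positive_definite_sum:
  assumes "\<And>i. i \<in> A \<Longrightarrow> positive_definite d (f i)"
  shows "positive_definite d (\<lambda>x. \<Sum>i\<in>A. f i x)"
  using assms
proof (induction A rule: infinite_finite_induct)
  case (insert i A)
  then show ?case
    by (simp add: positive_definite_add)
\<comment> \<open>The sum over an empty or an infinite set is 0, so both cases are the constant
  0.\<close>
qed (use positive_definite_const[of 0] in auto)

lemma positive_definite_scale:
  assumes "positive_definite d f" "0 \<le> a"
  shows "positive_definite d (\<lambda>x. complex_of_real a * f x)"
  unfolding positive_definite_def
proof (intro allI impI)
  fix n :: nat and x :: "nat \<Rightarrow> nat \<Rightarrow> real" and c :: "nat \<Rightarrow> complex"
  assume n: "1 \<le> n" and x: "\<forall>j<n. x j \<in> Rn d"
  let ?S = "\<Sum>j<n. \<Sum>k<n. cnj (c j) * c k * f (x j - x k)"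
  have "(\<Sum>j<n. \<Sum>k<n. cnj (c j) * c k * (complex_of_real a * f (x j - x k)))
      = complex_of_real a * ?S"
    by (simp add: sum_distrib_left mult_ac)
  moreover have "?S \<in> \<real>" "0 \<le> Re ?S"
    using assms(1) n x unfolding positive_definite_def by blast+
  ultimately show "(\<Sum>j<n. \<Sum>k<n. cnj (c j) * c k * (complex_of_real a * f (x j - x k))) \<in> \<real> \<and>
      0 \<le> Re (\<Sum>j<n. \<Sum>k<n. cnj (c j) * c k * (complex_of_real a * f (x j - x k)))"
    using assms(2) by simp
qed

lemma positive_definite_cos_mult:
  assumes "positive_definite d f"
  shows "positive_definite d (\<lambda>x. complex_of_real (cos (x i)) * f x)"
  unfolding positive_definite_def
proof (intro allI impI)
  fix n :: nat and x :: "nat \<Rightarrow> nat \<Rightarrow> real" and c :: "nat \<Rightarrow> complex"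
  assume n: "1 \<le> n" and x: "\<forall>j<n. x j \<in> Rn d"
  define S where "S b = (\<Sum>j<n. \<Sum>k<n. cnj (b j) * b k * f (x j - x k))" for b :: "nat \<Rightarrow> complex"
  have S: "S b \<in> \<real>" "0 \<le> Re (S b)" for b
    using assms n x unfolding positive_definite_def S_def by blast+
  \<comment> \<open>cos(a - b) = cos a cos b + sin a sin b splits the form into two forms of
    \<open>f\<close> at the same points. The cosines and sines are real, hence fixed by
    \<open>cnj\<close>, and can be absorbed into the coefficients.\<close>
  have "(\<Sum>j<n. \<Sum>k<n. cnj (c j) * c k * (complex_of_real (cos ((x j - x k) i)) * f (x j - x k)))
      = S (\<lambda>j. c j * complex_of_real (cos (x j i))) + S (\<lambda>j. c j * complex_of_real (sin (x j i)))"
    unfolding S_def sum.distrib[symmetric]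
    by (intro sum.cong refl) (simp add: cos_diff algebra_simps)
  then show "(\<Sum>j<n. \<Sum>k<n. cnj (c j) * c k * (complex_of_real (cos ((x j - x k) i)) * f (x j - x k))) \<in> \<real> \<and>
      0 \<le> Re (\<Sum>j<n. \<Sum>k<n. cnj (c j) * c k * (complex_of_real (cos ((x j - x k) i)) * f (x j - x k)))"
    using S by simp
qed

lemma positive_definite_prod_cos:
  "positive_definite d (\<lambda>x. complex_of_real (\<Prod>i\<in>I. cos (x i)))"
proof (induction I rule: infinite_finite_induct)
  case (insert i I)
  then show ?case
    using positive_definite_cos_mult[OF insert.IH, of i] by simp
qed (use positive_definite_const[of 1] in auto)

lemma positive_definite_elem_sym_cos:
  "positive_definite d (\<lambda>x. complex_of_real (elem_sym n r (\<lambda>i. cos (x i))))"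
  unfolding elem_sym_def of_real_sum
  by (intro positive_definite_sum positive_definite_prod_cos)

lemma positive_definite_f7: "positive_definite d (\<lambda>x. complex_of_real (f7 x))"
proof -
  let ?E = "\<lambda>r x. complex_of_real (elem_sym 7 r (\<lambda>i. cos (x i)))"
  \<comment> \<open>All coefficients are kept in the form \<open>complex_of_real a\<close>, so that
    the closure rules for scaling and constants match.\<close>
  have "(\<lambda>x. complex_of_real (f7 x)) = (\<lambda>x. complex_of_real (1/280) *
      (complex_of_real 21 + complex_of_real 4 * ?E 2 x + complex_of_real 4 * ?E 3 x + ?E 4 x))"
    by (simp add: f7_def P7_def)
  then show ?thesis
    by (auto intro!: positive_definite_scale positive_definite_add positive_definite_const
        positive_definite_elem_sym_cos simp del: of_real_divide of_real_numeral)
qed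

section \<open>Elementary symmetric polynomials: recursion and affinity\<close>

lemma elem_sym_0_right: "elem_sym n 0 y = 1"
proof -
  have "{I. I \<subseteq> {..<n} \<and> card I = 0} = {{}}"
    by (auto dest: finite_subset[OF _ finite_lessThan])
  then show ?thesis
    by (simp add: elem_sym_def)
qed

lemma elem_sym_0_Suc: "elem_sym 0 (Suc r) y = 0"
  by (auto simp: elem_sym_def intro!: sum.neutral)

text \<open>The index sets are split by membership of \<open>n\<close>; removing \<open>n\<close>
  from those that contain it leaves the \<open>r\<close>-subsets and extracts the factor
  \<open>y n\<close>.\<close>

lemma elem_sym_Suc_Suc:
  "elem_sym (Suc n) (Suc r) y = elem_sym n (Suc r) y + y n * elem_sym n r y"
proof -
  let ?A = "{I. I \<subseteq> {..<n} \<and> card I = Suc r}" and ?B = "{I. I \<subseteq> {..<n} \<and> card I = r}"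
  have fin: "finite I" and notin: "n \<notin> I" if "I \<subseteq> {..<n}" for I
    using that finite_subset by auto
  have "{I. I \<subseteq> {..<Suc n} \<and> card I = Suc r} = ?A \<union> insert n ` ?B"
  proof (intro equalityI subsetI)
    fix I assume I: "I \<in> {I. I \<subseteq> {..<Suc n} \<and> card I = Suc r}"
    show "I \<in> ?A \<union> insert n ` ?B"
    proof (cases "n \<in> I")
      case True
      then have "I = insert n (I - {n})" "I - {n} \<in> ?B"
        using I by (auto simp: less_Suc_eq)
      then show ?thesis by blast
    next
      case False
      then show ?thesis using I by (auto simp: less_Suc_eq subset_iff)
    qed
  qed (auto simp: fin notin less_Suc_eq)
  moreover have "inj_on (insert n) ?B"
    by (rule inj_onI) (use notin in \<open>metis (lifting) insert_ident mem_Collect_eq\<close>)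
  moreover have "?A \<inter> insert n ` ?B = {}"
    using notin by auto
  ultimately show ?thesis
    by (simp add: elem_sym_def sum.union_disjoint sum.reindex sum_distrib_left fin notin)
qed

text \<open>Each monomial contains \<open>y i\<close> at most once, so the dependence on
  \<open>t\<close> is affine and is recovered by interpolation between 1 and -1. For
  \<open>t\<close> in [-1, 1] the two weights make this a convex combination.\<close>

lemma elem_sym_affine:
  "elem_sym n r (y(i := t))
    = (1 + t) / 2 * elem_sym n r (y(i := 1)) + (1 - t) / 2 * elem_sym n r (y(i := -1))"
proof -
  have "(\<Prod>j\<in>I. (y(i := t)) j)
      = (1 + t) / 2 * (\<Prod>j\<in>I. (y(i := 1)) j) + (1 - t) / 2 * (\<Prod>j\<in>I. (y(i := -1)) j)"
    if "I \<subseteq> {..<n}" for I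
  proof -
    have *: "(\<Prod>j\<in>I. (y(i := s)) j) = (if i \<in> I then s else 1) * (\<Prod>j\<in>I - {i}. y j)" for s
    proof -
      have "(\<Prod>j\<in>I - {i}. (y(i := s)) j) = (\<Prod>j\<in>I - {i}. y j)"
        by (intro prod.cong) auto
      then show ?thesis
        using finite_subset[OF that finite_lessThan]
        by (cases "i \<in> I") (simp_all add: prod.remove[of I i "y(i := s)"] fun_upd_same del: fun_upd_apply)
    qed
    show ?thesis
      unfolding * by (simp add: field_simps)
  qed
  then show ?thesis
    by (simp add: elem_sym_def sum_distrib_left flip: sum.distrib)
qed

section \<open>Nonnegativity on the cube\<close>

lemma nonneg_on_cube_if_nonneg_on_vertices:
  fixes g :: "(nat \<Rightarrow> real) \<Rightarrow> real"
  assumes affine: "\<And>y i t. g (y(i := t)) = (1 + t) / 2 * g (y(i := 1)) + (1 - t) / 2 * g (y(i := -1))"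
    and vertex: "\<And>y. (\<And>i. i < n \<Longrightarrow> y i \<in> {-1, 1}) \<Longrightarrow> 0 \<le> g y"
    and cube: "\<And>i. i < n \<Longrightarrow> y i \<in> {-1..1}"
  shows "0 \<le> g y"
proof -
  \<comment> \<open>Only the first \<open>m\<close> coordinates may still lie strictly inside
    [-1, 1]. The induction step moves coordinate \<open>m\<close> to both ends of the interval and
    writes \<open>g y\<close> as a convex combination of the two values.\<close>
  have "m \<le> n \<Longrightarrow> (\<And>i. i < n \<Longrightarrow> y i \<in> {-1..1}) \<Longrightarrow>
      (\<And>i. i < n \<Longrightarrow> m \<le> i \<Longrightarrow> y i \<in> {-1, 1}) \<Longrightarrow> 0 \<le> g y" for m y
  proof (induction m arbitrary: y)
    case 0
    then show ?case by (auto intro: vertex)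
  next
    case (Suc m)
    have "0 \<le> g (y(m := s))" if "s \<in> {-1, 1}" for s
      using Suc.prems that by (intro Suc.IH) auto
    moreover have "y m \<in> {-1..1}"
      using Suc.prems by simp
    ultimately show ?case
      using affine[of y m "y m"] by simp
  qed
  from this[of n y] show ?thesis
    using cube by simp
qed

lemma P7_affine: "P7 (y(i := t)) = (1 + t) / 2 * P7 (y(i := 1)) + (1 - t) / 2 * P7 (y(i := -1))"
  unfolding P7_def elem_sym_affine[of 7 _ y i t] by (simp add: field_simps)

text \<open>E_1 does not occur in \<open>P7\<close>, but the recursion for E_2 uses it.\<close>

definition low_elem_syms :: "nat \<Rightarrow> (nat \<Rightarrow> real) \<Rightarrow> real \<times> real \<times> real \<times> real" where
  "low_elem_syms n y = (elem_sym n 1 y, elem_sym n 2 y, elem_sym n 3 y, elem_sym n 4 y)"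

text \<open>These are the coefficients of t, ..., t^4 in (1 + a t + b t^2 + c t^3 + d t^4)(1 + s t),
  the generating polynomial extended by one variable.\<close>

fun low_elem_syms_step :: "real \<times> real \<times> real \<times> real \<Rightarrow> real \<Rightarrow> real \<times> real \<times> real \<times> real" where
  "low_elem_syms_step (a, b, c, d) s = (a + s, b + s * a, c + s * b, d + s * c)"

lemma low_elem_syms_0: "low_elem_syms 0 y = (0, 0, 0, 0)"
  by (simp add: low_elem_syms_def numeral_eq_Suc elem_sym_0_Suc)

lemma low_elem_syms_Suc: "low_elem_syms (Suc n) y = low_elem_syms_step (low_elem_syms n y) (y n)"
  by (simp add: low_elem_syms_def numeral_eq_Suc elem_sym_0_right elem_sym_Suc_Suc)

text \<open>Turns the evaluation of \<open>P7\<close> at an explicit point into a computation by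
  simplification.\<close>

lemma low_elem_syms_7:
  "low_elem_syms 7 y = foldl low_elem_syms_step (0, 0, 0, 0) [y 0, y 1, y 2, y 3, y 4, y 5, y 6]"
proof -
  have "low_elem_syms n y = foldl low_elem_syms_step (0, 0, 0, 0) (map y [0..<n])" for n
    by (induction n) (simp_all add: low_elem_syms_0 low_elem_syms_Suc)
  from this[of 7] show ?thesis
    by (simp add: upt_conv_Cons numeral_eq_Suc)
qed

lemma P7_low_elem_syms:
  "P7 y = (case low_elem_syms 7 y of (_, b, c, d) \<Rightarrow> (21 + 4 * b + 4 * c + d) / 280)"
  by (simp add: P7_def low_elem_syms_def)

text \<open>By symmetry the tuple depends only on how many entries are -1, so n + 1 tuples cover all
  2^n sign patterns of the first n entries. They are listed by increasing number of entries
  -1.\<close>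

lemma P7_vertex_nonneg:
  assumes "\<And>i. i < 7 \<Longrightarrow> y i \<in> {-1, 1}"
  shows "0 \<le> P7 y"
proof -
  let ?T = "\<lambda>n. low_elem_syms n y" and ?next = low_elem_syms_step
  \<comment> \<open>If \<open>A\<close> contains the tuple so far, then \<open>B\<close> need only
    contain its successors for the next entry 1 and -1.\<close>
  have step: "?T m \<in> B" if "?T n \<in> A" "n < 7" "m = Suc n"
      "(\<lambda>t. ?next t 1) ` A \<union> (\<lambda>t. ?next t (-1)) ` A \<subseteq> B" for n m A B
    using assms[OF \<open>n < 7\<close>] that by (auto simp: low_elem_syms_Suc)
  have "?T 0 \<in> {(0, 0, 0, 0)}"
    by (simp add: low_elem_syms_0)
  then have "?T 1 \<in> {(1, 0, 0, 0), (-1, 0, 0, 0)}"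
    by (rule step) simp_all
  then have "?T 2 \<in> {(2, 1, 0, 0), (0, -1, 0, 0), (-2, 1, 0, 0)}"
    by (rule step) simp_all
  then have "?T 3 \<in> {(3, 3, 1, 0), (1, -1, -1, 0), (-1, -1, 1, 0), (-3, 3, -1, 0)}"
    by (rule step) simp_all
  then have "?T 4 \<in> {(4, 6, 4, 1), (2, 0, -2, -1), (0, -2, 0, 1), (-2, 0, 2, -1), (-4, 6, -4, 1)}"
    by (rule step) simp_all
  then have "?T 5 \<in> {(5, 10, 10, 5), (3, 2, -2, -3), (1, -2, -2, 1), (-1, -2, 2, 1), (-3, 2, 2, -3), (-5, 10, -10, 5)}"
    by (rule step) simp_all
  then have "?T 6 \<in> {(6, 15, 20, 15), (4, 5, 0, -5), (2, -1, -4, -1), (0, -3, 0, 3), (-2, -1, 4, -1), (-4, 5, 0, -5), (-6, 15, -20, 15)}"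
    by (rule step) simp_all
  then have "?T 7 \<in> {(7, 21, 35, 35), (5, 9, 5, -5), (3, 1, -5, -5), (1, -3, -3, 3), (-1, -3, 3, 3), (-3, 1, 5, -5), (-5, 9, -5, -5), (-7, 21, -35, 35)}"
    by (rule step) simp_all
  then show ?thesis
    by (auto simp: P7_low_elem_syms)
qed

lemma f7_nonneg: "0 \<le> f7 x"
  unfolding f7_def
  by (rule nonneg_on_cube_if_nonneg_on_vertices[where g = P7 and n = 7, OF P7_affine P7_vertex_nonneg])
    auto

section \<open>Boundedness and continuity\<close>

lemma bounded_f7: "bounded (range f7)"
proof -
  have E: "\<bar>elem_sym 7 r (\<lambda>i. cos (x i))\<bar> \<le> real (7 choose r)" for r x
  proof -
    have "\<bar>elem_sym 7 r (\<lambda>i. cos (x i))\<bar>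
        \<le> (\<Sum>I | I \<subseteq> {..<7::nat} \<and> card I = r. \<bar>\<Prod>i\<in>I. cos (x i)\<bar>)"
      unfolding elem_sym_def by (rule sum_abs)
    also have "\<dots> \<le> (\<Sum>I | I \<subseteq> {..<7::nat} \<and> card I = r. 1)"
      by (intro sum_mono) (auto simp: abs_prod intro!: prod_le_1)
    also have "\<dots> = real (7 choose r)"
      by (simp add: n_subsets)
    finally show ?thesis .
  qed
  have "7 choose 2 = (21::nat)" "7 choose 3 = (35::nat)" "7 choose 4 = (35::nat)"
    by (simp_all add: numeral_eq_Suc)
  \<comment> \<open>The bound is (21 + 4 * 21 + 4 * 35 + 35) / 280 = 1.\<close>
  then have "\<bar>f7 x\<bar> \<le> 1" for x
    using E[of 2 x] E[of 3 x] E[of 4 x] by (simp add: f7_def P7_def)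
  then show ?thesis
    by (auto simp: bounded_iff)
qed

lemma continuous_map_f7: "continuous_map (Euclidean_space d) euclideanreal f7"
proof -
  have proj: "continuous_map (Euclidean_space d) euclideanreal (\<lambda>x. x i)" for i
    unfolding Euclidean_space_def
    by (intro continuous_map_from_subtopology continuous_map_product_projection) simp
  have "continuous_map (Euclidean_space d) euclideanreal (\<lambda>x. cos (x i))" for i
    using continuous_map_compose[OF proj[of i], of euclideanreal cos]
    by (simp add: o_def continuous_on_cos)
  then show ?thesis
    unfolding f7_def P7_def elem_sym_def
    by (intro continuous_intros) (auto intro: finite_subset)
qed

section \<open>Values of \<open>f7\<close> and the quadratic form\<close>

lemma f7_0: "f7 0 = 1"
  by (simp add: f7_def P7_low_elem_syms low_elem_syms_7)

lemma f7_minus: "f7 (- x) = f7 x"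
  by (simp add: f7_def)

lemma atLeastAtMost_1_7: "{1..7::nat} = {1, 2, 3, 4, 5, 6, 7}"
  by auto

text \<open>Exactly one cosine is -1, the others are 1, which gives 72/280.\<close>

lemma f7_pi_unit_vector:
  assumes "j \<in> {1..7}"
  shows "f7 (\<lambda>i. pi * unit_vector j i) = 9 / 35"
  using assms unfolding atLeastAtMost_1_7
  by (auto simp: f7_def P7_low_elem_syms unit_vector_def low_elem_syms_7)

text \<open>Exactly two cosines are -1, those at the coordinates pi and -pi; there \<open>P7\<close>
  vanishes.\<close>

lemma f7_pi_unit_vector_diff:
  assumes "j \<in> {1..7}" "k \<in> {1..7}" "j \<noteq> k"
  shows "f7 ((\<lambda>i. pi * unit_vector j i) - (\<lambda>i. pi * unit_vector k i)) = 0"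
  using assms unfolding atLeastAtMost_1_7
  by (elim insertE emptyE; hypsubst; simp add: f7_def P7_low_elem_syms unit_vector_def low_elem_syms_7)

text \<open>The form is summed row by row: -4/5 from row 0 and 26/35 from each of the seven others,
  in total 22/5. The coefficients sum to 6, and 22/5 - 36/8 = -1/10.\<close>

lemma f7_quadratic_form:
  fixes x :: "nat \<Rightarrow> nat \<Rightarrow> real" and c :: "nat \<Rightarrow> real"
  assumes x0: "x 0 = 0" and x: "\<And>j. j \<in> {1..7} \<Longrightarrow> x j = (\<lambda>i. pi * unit_vector j i)"
    and c: "c 0 = -1" "\<And>j. j \<in> {1..7} \<Longrightarrow> c j = 1"
  shows "(\<Sum>j=0..7. \<Sum>k=0..7. c j * c k * f7 (x j - x k)) - 1 / 8 * (\<Sum>j=0..7. c j)\<^sup>2 = - 1 / 10"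
proof -
  have split: "(\<Sum>j=0..7. g j) = g 0 + (\<Sum>j=1..7. g j)" for g :: "nat \<Rightarrow> real"
    by (simp add: sum.atLeast_Suc_atMost)
  \<comment> \<open>Row \<open>j\<close> has 1 on the diagonal, -9/35 in column 0 and 0
    elsewhere.\<close>
  have "(\<Sum>k=0..7. c j * c k * f7 (x j - x k)) = 26 / 35" if j: "j \<in> {1..7}" for j
  proof -
    have "(\<Sum>k=1..7. c j * c k * f7 (x j - x k)) = (\<Sum>k=1..7. if k = j then 1 else 0)"
      using j by (intro sum.cong refl) (auto simp: x c f7_pi_unit_vector_diff f7_0)
    moreover have "f7 (x j - x 0) = 9 / 35"
      using j by (simp add: x0 x f7_pi_unit_vector)
    ultimately show ?thesis
      using j by (simp add: split c)
  qed
  \<comment> \<open>Row 0 has 1 on the diagonal and seven entries -9/35; evenness of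
    \<open>f7\<close> handles the differences 0 - \<open>x k\<close>.\<close>
  moreover have "(\<Sum>k=0..7. c 0 * c k * f7 (x 0 - x k)) = - 4 / 5"
  proof -
    have "(\<Sum>k=1..7. c 0 * c k * f7 (x 0 - x k)) = (\<Sum>k=1..7::nat. - 9 / 35)"
      by (intro sum.cong refl) (simp add: x0 x c f7_minus f7_pi_unit_vector)
    then show ?thesis
      by (simp add: split c f7_0)
  qed
  ultimately have "(\<Sum>j=0..7. \<Sum>k=0..7. c j * c k * f7 (x j - x k)) = - 4 / 5 + (\<Sum>j=1..7::nat. 26 / 35)"
    unfolding split[of "\<lambda>j. \<Sum>k=0..7. c j * c k * f7 (x j - x k)"]
    by (intro arg_cong2[of _ _ _ _ "(+)"] sum.cong refl)
  then have "(\<Sum>j=0..7. \<Sum>k=0..7. c j * c k * f7 (x j - x k)) = 22 / 5"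
    by simp
  moreover have "(\<Sum>j=0..7. c j) = 6"
    by (simp add: split c)
  ultimately show ?thesis
    by simp
qed

section \<open>The matrix inequality and its failure\<close>

lemma pi_unit_vector_in_Rn:
  assumes "j \<le> d"
  shows "(\<lambda>i. pi * unit_vector j i) \<in> Rn d"
  \<comment> \<open>Unit vectors are counted from 1, so the nonzero entry has index
    \<open>j - 1\<close>, below \<open>d\<close>; for \<open>j = 0\<close> the vector is
    zero.\<close>
  using assms by (auto simp: topspace_Euclidean_space unit_vector_def)

lemma zero_in_Rn: "0 \<in> Rn d"
  by (simp add: topspace_Euclidean_space)

text \<open>Passes from the matrix formulation to double sums; the all-ones matrix contributes the
  squared sum of the coefficients.\<close>

lemma scalar_prod_kernel_minus_all_ones:
  fixes h :: "(nat \<Rightarrow> real) \<Rightarrow> real"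
  shows "scalar_prod (vec n c)
      ((Matrix.mat n n (\<lambda>(j, k). h (x j - x k)) - a \<cdot>\<^sub>m all_ones_mat n) *\<^sub>v vec n c)
    = (\<Sum>j<n. \<Sum>k<n. c j * c k * h (x j - x k)) - a * (\<Sum>j<n. c j)\<^sup>2"
  by (simp add: scalar_prod_def all_ones_mat_def atLeast0LessThan power2_eq_square sum_product
      sum_distrib_left algebra_simps flip: sum_subtractf)

lemma f7_kernel_not_pos_semidef:
  fixes x :: "nat \<Rightarrow> nat \<Rightarrow> real"
  assumes "x 0 = 0" "\<And>j. j \<in> {1..7} \<Longrightarrow> x j = (\<lambda>i. pi * unit_vector j i)"
  shows "\<not> pos_semidef_mat
    (Matrix.mat 8 8 (\<lambda>(j, k). f7 (x j - x k)) - (1 / real 8) \<cdot>\<^sub>m all_ones_mat 8)"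
proof
  let ?A = "Matrix.mat 8 8 (\<lambda>(j, k). f7 (x j - x k)) - (1 / real 8) \<cdot>\<^sub>m all_ones_mat 8"
  assume A: "pos_semidef_mat ?A"
  \<comment> \<open>The test vector (-1, 1, ..., 1), on which the form takes the value
    -1/10.\<close>
  define c :: "nat \<Rightarrow> real" where "c j = (if j = 0 then -1 else 1)" for j
  have "vec 8 c \<in> carrier_vec (dim_row ?A)"
    by (simp add: all_ones_mat_def)
  then have "0 \<le> scalar_prod (vec 8 c) (?A *\<^sub>v vec 8 c)"
    using A unfolding pos_semidef_mat_def by blast
  also have "\<dots> = (\<Sum>j<8. \<Sum>k<8. c j * c k * f7 (x j - x k)) - 1 / 8 * (\<Sum>j<8. c j)\<^sup>2"
    by (simp add: scalar_prod_kernel_minus_all_ones)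
  also have "{..<8::nat} = {0..7}"
    by auto
  also have "(\<Sum>j=0..7. \<Sum>k=0..7. c j * c k * f7 (x j - x k)) - 1 / 8 * (\<Sum>j=0..7. c j)\<^sup>2 = - 1 / 10"
    by (rule f7_quadratic_form) (use assms in \<open>auto simp: c_def\<close>)
  finally show False
    by simp
qed

theorem theorem1:
  shows "bounded (f7 ` Rn 7)
    \<and> continuous_map (Euclidean_space 7) euclideanreal f7
    \<and> (\<forall>x \<in> Rn 7. f7 x \<ge> 0)
    \<and> positive_definite 7 (\<lambda>x. complex_of_real (f7 x))
    \<and> f7 0 = 1
    \<and> (\<forall>(x :: nat \<Rightarrow> nat \<Rightarrow> real) (c :: nat \<Rightarrow> real).
         x 0 = 0 \<and> (\<forall>j\<in>{1..7}. x j = (\<lambda>i. pi * unit_vector j i)) \<and>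
         c 0 = -1 \<and> (\<forall>j\<in>{1..7}. c j = 1) \<longrightarrow>
         (\<forall>j\<le>7. x j \<in> Rn 7) \<and>
         (\<Sum>j=0..7. \<Sum>k=0..7. c j * c k * f7 (x j - x k)) - 1 / 8 * (\<Sum>j=0..7. c j)\<^sup>2 = - 1 / 10)
    \<and> \<not> (\<forall>d\<ge>1. \<forall>h :: (nat \<Rightarrow> real) \<Rightarrow> real.
           bounded (h ` Rn d) \<and> continuous_map (Euclidean_space d) euclideanreal h \<and>
           (\<forall>x \<in> Rn d. h x \<ge> 0) \<and> positive_definite d (\<lambda>x. complex_of_real (h x)) \<and>
           h 0 = 1 \<longrightarrow>
           (\<forall>n\<ge>1. \<forall>x :: nat \<Rightarrow> nat \<Rightarrow> real. (\<forall>j<n. x j \<in> Rn d) \<longrightarrow>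
              pos_semidef_mat
                (Matrix.mat n n (\<lambda>(j, k). h (x j - x k)) - (1 / real n) \<cdot>\<^sub>m all_ones_mat n)))"
  (is "?B \<and> ?C \<and> ?N \<and> ?PD \<and> ?Z \<and> ?Q \<and> \<not> ?F")
proof (intro conjI)
  show b: ?B
    using bounded_f7 by (rule bounded_subset) auto
  show ?C ?N ?PD ?Z
    by (simp_all add: continuous_map_f7 f7_nonneg positive_definite_f7 f7_0)
  show ?Q
  proof (intro allI impI)
    fix x :: "nat \<Rightarrow> nat \<Rightarrow> real" and c :: "nat \<Rightarrow> real"
    assume *: "x 0 = 0 \<and> (\<forall>j\<in>{1..7}. x j = (\<lambda>i. pi * unit_vector j i)) \<and>
      c 0 = -1 \<and> (\<forall>j\<in>{1..7}. c j = 1)"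
    have "x j \<in> Rn 7" if "j \<le> 7" for j
      using * that pi_unit_vector_in_Rn[OF that] zero_in_Rn[of 7] by (cases "j = 0") auto
    moreover have "(\<Sum>j=0..7. \<Sum>k=0..7. c j * c k * f7 (x j - x k)) - 1 / 8 * (\<Sum>j=0..7. c j)\<^sup>2
        = - 1 / 10"
      by (rule f7_quadratic_form) (use * in blast)+
    ultimately show "(\<forall>j\<le>7. x j \<in> Rn 7) \<and>
      (\<Sum>j=0..7. \<Sum>k=0..7. c j * c k * f7 (x j - x k)) - 1 / 8 * (\<Sum>j=0..7. c j)\<^sup>2 = - 1 / 10"
      by blast
  qed
  show "\<not> ?F"
  proof
    assume F: ?F
    \<comment> \<open>The first eight terms are the points 0, pi e_1, ..., pi e_7, at which
      \<open>f7\<close> refutes the assertion with d = 7 and n = 8.\<close>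
    define x :: "nat \<Rightarrow> nat \<Rightarrow> real"
      where "x j = (if j = 0 then 0 else (\<lambda>i. pi * unit_vector j i))" for j
    have "\<forall>j<8. x j \<in> Rn 7"
      using pi_unit_vector_in_Rn[of _ 7] zero_in_Rn[of 7] by (simp add: x_def)
    then have "pos_semidef_mat
        (Matrix.mat 8 8 (\<lambda>(j, k). f7 (x j - x k)) - (1 / real 8) \<cdot>\<^sub>m all_ones_mat 8)"
      using F[rule_format, of 7 f7 8 x] b
      by (simp add: continuous_map_f7 f7_nonneg positive_definite_f7 f7_0)
    then show False
      using f7_kernel_not_pos_semidef[of x] by (simp add: x_def)
  qed
qed

end
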